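(* Let $p$ be a prime with $p \equiv 1 \pmod{3}$, and let $R = \Gamma_{\mathbb F_p}(p_1l_1,\; p_1p_2l_1(p_1+p_2+p_1p_2))$. Then $|\mathrm{Aut}(R)| = p$, and $R$ cannot be presented in the form $\Gamma_{\mathbb F_p}(p_1l_1, h(p_1,l_1))$, i.e., there is no function $h:\mathbb F_p^2\to\mathbb F_p$ such that $R$ is isomorphic to $\Gamma_{\mathbb F_p}(p_1l_1, h(p_1,l_1))$.
   Context: For a finite field $\mathbb F$ and functions $f:\mathbb F^2\to\mathbb F$, $g:\mathbb F^3\to\mathbb F$, the graph $\Gamma_{\mathbb F}(f(p_1,l_1), g(p_1,p_2,l_1))$ is the bipartite graph whose two parts are the set $P$ of points $(p_1,p_2,p_3)\in\mathbb F^3$ and the set $L$ of lines $[l_1,l_2,l_3]\in\mathbb F^3$ (two disjoint copies of $\mathbb F^3$), where a point $(p_1,p_2,p_3)$ is adjacent to a line $[l_1,l_2,l_3]$ if and only if $p_2+l_2 = f(p_1,l_1)$ and $p_3+l_3 = g(p_1,p_2,l_1)$. The graph $\Gamma_{\mathbb F}(f(p_1,l_1), h(p_1,l_1))$ is defined in the same way with $h:\mathbb F^2\to\mathbb F$ in place of $g$. $\mathrm{Aut}(\cdot)$ denotes the automorphism group of a graph. *)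

theory Defs
  imports "HOL-Algebra.Coset" "HOL-Computational_Algebra.Primes"
begin

text \<open>
  A graph on the vertex type \<open>'v\<close> is given by its adjacency relation; the vertex set is the
  whole type.
\<close>

type_synonym 'v graph = "'v \<Rightarrow> 'v \<Rightarrow> bool"

definition graph_isomorphism :: "'v graph \<Rightarrow> 'w graph \<Rightarrow> ('v \<Rightarrow> 'w) \<Rightarrow> bool" where
  "graph_isomorphism G H \<phi> \<longleftrightarrow> bij \<phi> \<and> (\<forall>u v. G u v \<longleftrightarrow> H (\<phi> u) (\<phi> v))"

definition graph_isomorphic :: "'v graph \<Rightarrow> 'w graph \<Rightarrow> bool" where
  "graph_isomorphic G H \<longleftrightarrow> (\<exists>\<phi>. graph_isomorphism G H \<phi>)"

text \<open>
  Automorphisms of a bipartite graph are automorphisms of the underlying graph: they are not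
  required to preserve the two parts.
\<close>

definition Aut :: "'v graph \<Rightarrow> ('v \<Rightarrow> 'v) monoid" where
  "Aut G = \<lparr>carrier = {\<phi>. graph_isomorphism G G \<phi>}, monoid.mult = (\<circ>), one = id\<rparr>"

datatype 'a vertex = Point 'a 'a 'a | Line 'a 'a 'a

text \<open>
  \<open>incident f g P L\<close> is the relation between points \<open>P\<close> and lines \<open>L\<close>; \<open>Gamma f g\<close> is the
  undirected bipartite graph it generates.
\<close>

fun incident :: "('a::{field,finite} \<Rightarrow> 'a \<Rightarrow> 'a) \<Rightarrow> ('a \<Rightarrow> 'a \<Rightarrow> 'a \<Rightarrow> 'a) \<Rightarrow>
    'a vertex \<Rightarrow> 'a vertex \<Rightarrow> bool" where
  "incident f g (Point p1 p2 p3) (Line l1 l2 l3) \<longleftrightarrow> p2 + l2 = f p1 l1 \<and> p3 + l3 = g p1 p2 l1"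
| "incident f g _ _ \<longleftrightarrow> False"

definition Gamma :: "('a::{field,finite} \<Rightarrow> 'a \<Rightarrow> 'a) \<Rightarrow> ('a \<Rightarrow> 'a \<Rightarrow> 'a \<Rightarrow> 'a) \<Rightarrow>
    'a vertex graph" where
  "Gamma f g u v \<longleftrightarrow> incident f g u v \<or> incident f g v u"

text \<open>The variant in which the third-coordinate function \<open>h\<close> does not depend on \<open>p\<^sub>2\<close>.\<close>

definition Gamma2 :: "('a::{field,finite} \<Rightarrow> 'a \<Rightarrow> 'a) \<Rightarrow> ('a \<Rightarrow> 'a \<Rightarrow> 'a) \<Rightarrow> 'a vertex graph" where
  "Gamma2 f h = Gamma f (\<lambda>p1 p2 l1. h p1 l1)"

definition R_graph :: "'a::{field,finite} vertex graph" where
  "R_graph = Gamma (\<lambda>p1 l1. p1 * l1) (\<lambda>p1 p2 l1. p1 * p2 * l1 * (p1 + p2 + p1 * p2))"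

lemma group_Aut: "group (Aut G)"
proof (rule groupI)
  fix \<phi> assume "\<phi> \<in> carrier (Aut G)"
  then have *: "bij \<phi>" "\<And>u v. G u v \<longleftrightarrow> G (\<phi> u) (\<phi> v)"
    by (auto simp: Aut_def graph_isomorphism_def)
  have "G u v \<longleftrightarrow> G (inv_into UNIV \<phi> u) (inv_into UNIV \<phi> v)" for u v
    using *(2)[of "inv_into UNIV \<phi> u" "inv_into UNIV \<phi> v"] *(1) by (simp add: bij_is_surj surj_f_inv_f)
  then have "inv_into UNIV \<phi> \<in> carrier (Aut G)"
    using *(1) by (simp add: Aut_def graph_isomorphism_def bij_imp_bij_inv)
  moreover have "inv_into UNIV \<phi> \<otimes>\<^bsub>Aut G\<^esub> \<phi> = \<one>\<^bsub>Aut G\<^esub>"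
    using *(1) by (simp add: Aut_def bij_is_inj)
  ultimately show "\<exists>\<psi>\<in>carrier (Aut G). \<psi> \<otimes>\<^bsub>Aut G\<^esub> \<phi> = \<one>\<^bsub>Aut G\<^esub>" by blast
qed (auto simp: Aut_def graph_isomorphism_def comp_assoc intro: bij_comp)

end

(* Put G(a, b) = ab(a + b + ab), so that the third equation of R is p3 + l3 = l1 G(p1, p2), and call a
   non-adjacent pair saturated if it is joined by p - 1 paths of length 3, the largest number possible.
   For a point (a0, b0, c0) and a line [x, y, z], saturation says that the quartic polynomial
   G(a, xa - y) - G(a0, b0) is a multiple of a - a0, hence of degree at most 1; this forces the line
   to be [0, 0, z] or [0, 1, z].  The lines of these two families lie in 2p - 3 and 2p - 4 saturated
   pairs, every other vertex in at most 2, so each family is preserved by every automorphism.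
   Modulo the translations of the third coordinate the automorphism fixes these lines pointwise, then
   the points with a = 0, so that lines keep their last two coordinates, then the lines with x = 0,
   so that points keep b and c.  Since G(a, b) / a is injective in a for b different from 0 and -1,
   it fixes the remaining vertices.  A graph with h(p1, l1) has at least p^2 automorphisms. *)

theory Submission
  imports Defs "HOL-Computational_Algebra.Polynomial" "HOL-Number_Theory.Residues"
begin

hide_const (open) Polynomial.order

definition three_paths :: "'v graph \<Rightarrow> 'v \<Rightarrow> 'v \<Rightarrow> ('v \<times> 'v) set" where
  "three_paths H u v = {(m, w). H u m \<and> H m w \<and> H w v}"

definition saturated :: "'v graph \<Rightarrow> nat \<Rightarrow> 'v \<Rightarrow> 'v \<Rightarrow> bool" where
  "saturated H n u v \<longleftrightarrow> \<not> H u v \<and> card (three_paths H u v) = n"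

lemma saturated_sym:
  assumes "\<And>u v. H u v \<longleftrightarrow> H v u"
  shows "saturated H n u v \<longleftrightarrow> saturated H n v u"
proof -
  have "three_paths H v u = prod.swap ` three_paths H u v"
    unfolding three_paths_def using assms by auto
  then have "card (three_paths H v u) = card (three_paths H u v)"
    by (simp add: card_image)
  then show ?thesis
    using assms by (simp add: saturated_def)
qed

lemma saturated_automorphism:
  assumes "graph_isomorphism H H \<phi>"
  shows "saturated H n (\<phi> u) (\<phi> v) \<longleftrightarrow> saturated H n u v"
proof -
  have bij: "bij \<phi>" and adj: "\<And>u v. H (\<phi> u) (\<phi> v) \<longleftrightarrow> H u v"
    using assms by (auto simp: graph_isomorphism_def)
  have "three_paths H (\<phi> u) (\<phi> v) = map_prod \<phi> \<phi> ` three_paths H u v"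
  proof (intro equalityI subsetI)
    fix q assume "q \<in> three_paths H (\<phi> u) (\<phi> v)"
    then obtain m w where "q = (m, w)" "H (\<phi> u) m" "H m w" "H w (\<phi> v)"
      by (auto simp: three_paths_def)
    moreover obtain m' w' where "m = \<phi> m'" "w = \<phi> w'"
      using bij by (metis bij_pointE)
    ultimately show "q \<in> map_prod \<phi> \<phi> ` three_paths H u v"
      using adj by (auto simp: three_paths_def)
  qed (use adj in \<open>auto simp: three_paths_def\<close>)
  moreover have "inj (map_prod \<phi> \<phi>)"
    using bij by (simp add: bij_is_inj prod.inj_map)
  ultimately have "card (three_paths H (\<phi> u) (\<phi> v)) = card (three_paths H u v)"
    by (metis card_image inj_on_subset subset_UNIV)
  then show ?thesis
    by (simp add: saturated_def adj)
qed

lemma card_saturated_automorphism: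
  assumes "graph_isomorphism H H \<phi>"
  shows "card {u. saturated H n u (\<phi> v)} = card {u. saturated H n u v}"
proof -
  have bij: "bij \<phi>"
    using assms by (simp add: graph_isomorphism_def)
  have "{u. saturated H n u (\<phi> v)} = \<phi> ` {u. saturated H n u v}"
    using saturated_automorphism[OF assms] bij by (auto simp: image_iff) (metis bij_pointE)
  then show ?thesis
    using bij by (simp add: bij_is_inj card_image inj_on_subset[OF _ subset_UNIV])
qed

definition height :: "'a::comm_ring_1 \<Rightarrow> 'a \<Rightarrow> 'a" where
  "height a b = a * b * (a + b + a * b)"

lemma R_graph_simps [simp]:
  "R_graph (Point a b c) (Line x y z) \<longleftrightarrow> b + y = a * x \<and> c + z = x * height a b"
  "R_graph (Line x y z) (Point a b c) \<longleftrightarrow> b + y = a * x \<and> c + z = x * height a b"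
  "\<not> R_graph (Point a b c) (Point a' b' c')"
  "\<not> R_graph (Line x y z) (Line x' y' z')"
  by (auto simp: R_graph_def Gamma_def height_def algebra_simps)

lemma R_graph_sym: "R_graph u v \<longleftrightarrow> R_graph v u"
  by (auto simp: R_graph_def Gamma_def)

text \<open>
  A path of length 3 from the point to the line is determined by the coordinate \<open>a\<close> of its second
  point.
\<close>

lemma card_three_paths:
  fixes a0 b0 c0 x y z :: "'a::{field,finite}"
  assumes nonadj: "\<not> R_graph (Point a0 b0 c0) (Line x y z)"
  defines "h \<equiv> x * a0 - y - b0"
  shows "card (three_paths R_graph (Point a0 b0 c0) (Line x y z)) =
    card {a. a \<noteq> a0 \<and> h \<noteq> 0 \<and> h * (height a (x * a - y) - height a0 b0) =
      (x * height a0 b0 - z - c0) * (a - a0)}"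
proof -
  let ?g = height
  let ?G0 = "height a0 b0"
  define A where "A = {a. a \<noteq> a0 \<and> h \<noteq> 0 \<and> h * (?g a (x * a - y) - ?G0) = (x * ?G0 - z - c0) * (a - a0)}"
  define s where "s a = (x * a - y - b0) / (a - a0)" for a
  define path where "path a = (Line (s a) (a0 * s a - b0) (s a * ?G0 - c0),
    Point a (x * a - y) (x * ?g a (x * a - y) - z))" for a
  have "three_paths R_graph (Point a0 b0 c0) (Line x y z) = path ` A"
  proof (intro equalityI subsetI)
    fix q assume "q \<in> three_paths R_graph (Point a0 b0 c0) (Line x y z)"
    then obtain m w where q: "q = (m, w)" and
      adj: "R_graph (Point a0 b0 c0) m" "R_graph m w" "R_graph w (Line x y z)"
      by (auto simp: three_paths_def)
    obtain t y1 z1 where m: "m = Line t y1 z1"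
      using adj(1) by (cases m) auto
    obtain a b c where w: "w = Point a b c"
      using adj(3) by (cases w) auto
    have eqs: "b0 + y1 = a0 * t" "c0 + z1 = t * ?G0" "b + y1 = a * t" "c + z1 = t * ?g a b"
      "b + y = a * x" "c + z = x * ?g a b"
      using adj by (auto simp: m w)
    have "a \<noteq> a0"
    proof
      assume "a = a0"
      with eqs have "b = b0" by (metis add_right_imp_eq)
      with eqs \<open>a = a0\<close> have "c = c0" by (metis add_right_imp_eq)
      with adj(3) nonadj \<open>a = a0\<close> \<open>b = b0\<close> show False by (simp add: w)
    qed
    have b: "b = x * a - y" using eqs by (simp add: algebra_simps)
    have t: "t * (a - a0) = x * a - y - b0"
    proof -
      have "t * (a - a0) = (b + y1) - (b0 + y1)" by (simp add: eqs algebra_simps)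
      then show ?thesis by (simp add: b)
    qed
    then have ts: "t = s a"
      using \<open>a \<noteq> a0\<close> by (simp add: s_def field_simps)
    have "h \<noteq> 0"
    proof
      assume "h = 0"
      then have "t * (a - a0) = x * (a - a0)" using t by (simp add: h_def algebra_simps)
      then have "t = x" using \<open>a \<noteq> a0\<close> by simp
      with eqs have "y1 = y" by (metis add_left_imp_eq)
      with eqs \<open>t = x\<close> have "z1 = z" by (metis add_left_imp_eq)
      with adj(1) nonadj \<open>t = x\<close> \<open>y1 = y\<close> show False by (simp add: m)
    qed
    moreover have "h * (?g a (x * a - y) - ?G0) = (x * ?G0 - z - c0) * (a - a0)"
    proof -
      have "(t - x) * (a - a0) = h"
        using t by (simp add: h_def algebra_simps)
      moreover have "(t - x) * (?g a b - ?G0) = x * ?G0 - z - c0"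
      proof -
        have "t * (?g a b - ?G0) = (c + z1) - (c0 + z1)"
          by (simp only: eqs right_diff_distrib)
        moreover have "x * ?g a b = c + z" by (simp only: eqs)
        ultimately show ?thesis by (simp add: algebra_simps)
      qed
      ultimately show ?thesis
        by (metis b mult.assoc mult.commute)
    qed
    ultimately have "a \<in> A" using \<open>a \<noteq> a0\<close> by (simp add: A_def)
    moreover have "q = path a"
      using eqs ts b by (auto simp: q m w path_def algebra_simps)
    ultimately show "q \<in> path ` A" by blast
  next
    fix q assume "q \<in> path ` A"
    then obtain a where a: "a \<in> A" and q: "q = path a" by blast
    have ne: "a - a0 \<noteq> 0" and
      cond: "h * (?g a (x * a - y) - ?G0) = (x * ?G0 - z - c0) * (a - a0)"
      using a by (auto simp: A_def)
    have s: "s a * (a - a0) = x * a - y - b0" using ne by (simp add: s_def)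
    have "(s a - x) * (a - a0) = h" using s by (simp add: h_def algebra_simps)
    then have "(s a - x) * (?g a (x * a - y) - ?G0) * (a - a0) = (x * ?G0 - z - c0) * (a - a0)"
      using cond by (metis mult.assoc mult.commute)
    then have "(s a - x) * (?g a (x * a - y) - ?G0) = x * ?G0 - z - c0"
      using ne by simp
    with s show "q \<in> three_paths R_graph (Point a0 b0 c0) (Line x y z)"
      by (simp add: q path_def three_paths_def algebra_simps)
  qed
  moreover have "inj_on path A"
    by (auto simp: inj_on_def path_def)
  ultimately show ?thesis by (simp add: card_image A_def)
qed

lemma quartic_eq_0:
  fixes c0 c1 c2 c3 c4 :: "'a::{field,finite}"
  assumes "card (UNIV :: 'a set) \<ge> 7"
    and "\<And>a. a \<noteq> a0 \<Longrightarrow> c0 + c1 * a + c2 * a^2 + c3 * a^3 + c4 * a^4 = 0"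
  shows "c0 = 0 \<and> c1 = 0 \<and> c2 = 0 \<and> c3 = 0 \<and> c4 = 0"
proof -
  let ?q = "[:c0, c1, c2, c3, c4:]"
  have "?q = 0"
  proof (rule ccontr)
    assume "?q \<noteq> 0"
    then have "card {a. poly ?q a = 0} \<le> degree ?q" by (rule card_poly_roots_bound)
    also have "\<dots> \<le> 4" by simp
    finally have "card {a. poly ?q a = 0} \<le> 4" .
    moreover have "UNIV - {a0} \<subseteq> {a. poly ?q a = 0}"
      using assms(2) by (auto simp: algebra_simps power_numeral_reduce)
    then have "card (UNIV - {a0}) \<le> card {a. poly ?q a = 0}"
      by (intro card_mono) auto
    ultimately show False using assms(1) by (simp add: card_Diff_singleton)
  qed
  then show ?thesis by simp
qed

definition R_saturated :: "'a::{field,finite} vertex \<Rightarrow> 'a vertex \<Rightarrow> bool" where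
  "R_saturated = saturated R_graph (card (UNIV :: 'a set) - 1)"

lemma R_saturated_sym: "R_saturated u v \<longleftrightarrow> R_saturated v u"
  unfolding R_saturated_def by (rule saturated_sym) (rule R_graph_sym)

lemma R_saturated_iff:
  fixes a0 b0 c0 x y z :: "'a::{field,finite}"
  assumes card: "card (UNIV :: 'a set) \<ge> 7"
  shows "R_saturated (Point a0 b0 c0) (Line x y z) \<longleftrightarrow>
    x = 0 \<and> (y = 0 \<and> b0 \<noteq> 0 \<and> c0 = - z \<and> (a0 = 0 \<or> a0 + b0 + a0 * b0 = 0) \<or>
             y = 1 \<and> b0 \<noteq> - 1 \<and> c0 = 1 + b0 - z \<and> (a0 = 0 \<or> (a0 + 1) * b0 = 1))"
    (is "?L \<longleftrightarrow> ?R")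
proof -
  let ?g = height
  let ?G0 = "height a0 b0"
  define h where "h = x * a0 - y - b0"
  define k where "k = x * ?G0 - z - c0"
  have L: "?L \<longleftrightarrow> \<not> R_graph (Point a0 b0 c0) (Line x y z) \<and>
      h \<noteq> 0 \<and> (\<forall>a. a \<noteq> a0 \<longrightarrow> h * (?g a (x * a - y) - ?G0) = k * (a - a0))"
  proof (cases "R_graph (Point a0 b0 c0) (Line x y z)")
    case False
    define A where "A = {a. a \<noteq> a0 \<and> h \<noteq> 0 \<and> h * (?g a (x * a - y) - ?G0) = k * (a - a0)}"
    have "?L \<longleftrightarrow> card A = card (UNIV - {a0})"
      using False card_three_paths[OF False]
      by (simp add: R_saturated_def saturated_def A_def h_def k_def card_Diff_singleton)
    also have "\<dots> \<longleftrightarrow> A = UNIV - {a0}"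
    proof -
      have "A \<subseteq> UNIV - {a0}" by (auto simp: A_def)
      then show ?thesis using card_subset_eq[OF finite] by metis
    qed
    also have "\<dots> \<longleftrightarrow> h \<noteq> 0 \<and> (\<forall>a. a \<noteq> a0 \<longrightarrow> h * (?g a (x * a - y) - ?G0) = k * (a - a0))"
    proof -
      have "card (UNIV - {a0}) \<noteq> 0" using card by (simp add: card_Diff_singleton)
      then have "UNIV - {a0} \<noteq> {}" by (metis card.empty)
      then show ?thesis unfolding A_def by blast
    qed
    finally show ?thesis using False by simp
  qed (simp add: R_saturated_def saturated_def)
  show ?thesis
  proof
    assume ?L
    then have h0: "h \<noteq> 0"
      and all: "\<And>a. a \<noteq> a0 \<Longrightarrow> h * (?g a (x * a - y) - ?G0) = k * (a - a0)"
      using L by auto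
    have "(k * a0 - h * ?G0) = 0 \<and> h * y^2 - k = 0 \<and> h * (y^2 - y - 2 * x * y) = 0 \<and>
      h * (x + x^2 - 2 * x * y) = 0 \<and> h * x^2 = 0"
    proof (rule quartic_eq_0[OF card])
      fix a assume "a \<noteq> a0"
      have "(k * a0 - h * q) + (h * y^2 - k) * a + h * (y^2 - y - 2 * x * y) * a^2 +
        h * (x + x^2 - 2 * x * y) * a^3 + h * x^2 * a^4 =
        h * (?g a (x * a - y) - q) - k * (a - a0)" for q
        unfolding height_def
        by (simp add: algebra_simps power2_eq_square power3_eq_cube power4_eq_xxxx)
      with all[OF \<open>a \<noteq> a0\<close>]
      show "(k * a0 - h * ?G0) + (h * y^2 - k) * a + h * (y^2 - y - 2 * x * y) * a^2 +
        h * (x + x^2 - 2 * x * y) * a^3 + h * x^2 * a^4 = 0"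
        by simp
    qed
    then have "x = 0" and k: "k = h * y^2" and G: "h * ?G0 = k * a0" and y: "y^2 = y"
      using h0 by auto
    have "y = 0 \<or> y = 1" using y by (auto simp: power2_eq_square)
    have G0: "?G0 = y^2 * a0" using G k h0 by (simp add: mult.assoc)
    from \<open>y = 0 \<or> y = 1\<close> show ?R
    proof
      assume "y = 0"
      then show ?R using \<open>x = 0\<close> h0 k G0
        by (auto simp: h_def k_def height_def eq_neg_iff_add_eq_0)
    next
      assume "y = 1"
      have "b0 \<noteq> -1" using h0 \<open>x = 0\<close> \<open>y = 1\<close> by (auto simp: h_def)
      then have "b0 + 1 \<noteq> 0" by (simp add: eq_neg_iff_add_eq_0)
      moreover have "a0 * ((a0 + 1) * b0 - 1) * (b0 + 1) = 0"
      proof -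
        have "a0 * ((a0 + 1) * b0 - 1) * (b0 + 1) = ?G0 - a0"
          by (simp add: height_def algebra_simps)
        then show ?thesis using G0 \<open>y = 1\<close> by simp
      qed
      ultimately have "a0 = 0 \<or> (a0 + 1) * b0 = 1" by simp
      moreover have "c0 = 1 + b0 - z"
      proof -
        have "- z - c0 = - 1 - b0" using k \<open>x = 0\<close> \<open>y = 1\<close> by (simp add: h_def k_def)
        then have "c0 = - z - (- 1 - b0)" by (metis diff_diff_eq2 add_diff_cancel_left')
        then show ?thesis by (simp add: algebra_simps)
      qed
      ultimately show ?R using \<open>x = 0\<close> \<open>y = 1\<close> \<open>b0 \<noteq> -1\<close> by simp
    qed
  next
    assume R: ?R
    then have "x = 0" by simp
    have h: "h = - y - b0" and k: "k = - z - c0" using \<open>x = 0\<close> by (auto simp: h_def k_def)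
    have "y + b0 \<noteq> 0" using R by (auto simp: add_eq_0_iff)
    then have "h \<noteq> 0" by (metis h diff_conv_add_uminus minus_add_distrib neg_equal_0_iff_equal)
    then have "\<not> R_graph (Point a0 b0 c0) (Line x y z)"
      using \<open>x = 0\<close> by (auto simp: h add_eq_0_iff)
    moreover have "h * (?g a (x * a - y) - ?G0) = k * (a - a0)" for a
      using R
    proof (elim conjE disjE)
      assume "y = 0" "c0 = - z" "a0 = 0"
      then show ?thesis using \<open>x = 0\<close> by (simp add: k height_def)
    next
      assume "y = 0" "c0 = - z" "a0 + b0 + a0 * b0 = 0"
      then show ?thesis using \<open>x = 0\<close> by (simp add: k height_def)
    next
      assume "y = 1" "c0 = 1 + b0 - z" "a0 = 0"
      then have "k = h" by (simp add: h k)
      then show ?thesis using \<open>x = 0\<close> \<open>y = 1\<close> \<open>a0 = 0\<close> by (simp add: height_def)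
    next
      assume y: "y = 1" "c0 = 1 + b0 - z" and ab: "(a0 + 1) * b0 = 1"
      have "?G0 = a0 * (b0 * ((a0 + 1) * b0 + a0))"
        by (simp add: height_def algebra_simps)
      also have "\<dots> = a0 * (b0 * (1 + a0))"
        by (simp only: ab)
      also have "\<dots> = a0 * ((a0 + 1) * b0)"
        by (simp add: algebra_simps)
      finally have "?G0 = a0" by (simp add: ab)
      moreover have "k = h" using y by (simp add: h k)
      ultimately show ?thesis using \<open>x = 0\<close> y by (simp add: height_def[of a])
    qed
    ultimately show ?L using L \<open>h \<noteq> 0\<close> by simp
  qed
qed

lemma R_saturated_bipartite:
  fixes a b c x y z :: "'a::{field,finite}"
  assumes "card (UNIV :: 'a set) \<ge> 7"
  shows "\<not> R_saturated (Point a b c) (Point x y z)"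
    and "\<not> R_saturated (Line a b c) (Line x y z)"
proof -
  have False if "R_graph (Point a b c) m" "R_graph m w" "R_graph w (Point x y z)" for m w
    using that by (cases m; cases w) auto
  then have "three_paths R_graph (Point a b c) (Point x y z) = {}"
    by (auto simp: three_paths_def)
  then show "\<not> R_saturated (Point a b c) (Point x y z)"
    using assms by (simp add: R_saturated_def saturated_def)
  have False if "R_graph (Line a b c) m" "R_graph m w" "R_graph w (Line x y z)" for m w
    using that by (cases m; cases w) auto
  then have "three_paths R_graph (Line a b c) (Line x y z) = {}"
    by (auto simp: three_paths_def)
  then show "\<not> R_saturated (Line a b c) (Line x y z)"
    using assms by (simp add: R_saturated_def saturated_def)
qed

lemma invariant_under_increment:
  fixes f :: "'a::{field,finite} \<Rightarrow> 'b"
  assumes "prime (card (UNIV :: 'a set))" and step: "\<And>c. f (c + 1) = f c"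
  shows "f c = f 0"
proof -
  let ?p = "card (UNIV :: 'a set)"
  have "CHAR('a) dvd ?p" by (rule CHAR_dvd_CARD)
  then have char: "CHAR('a) = ?p"
    using assms(1) by (metis CHAR_not_1 One_nat_def prime_nat_iff)
  have "inj_on (of_nat :: nat \<Rightarrow> 'a) {..<?p}"
    by (auto simp: inj_on_def of_nat_eq_iff_cong_CHAR char cong_def)
  then have "card ((of_nat :: nat \<Rightarrow> 'a) ` {..<?p}) = ?p"
    by (simp add: card_image)
  then have "(of_nat :: nat \<Rightarrow> 'a) ` {..<?p} = UNIV"
    by (intro card_subset_eq) auto
  then obtain n where "c = of_nat n" by (metis UNIV_I imageE)
  moreover have "f (of_nat n) = f 0" for n
    by (induction n) (simp, metis of_nat_Suc add.commute step)
  ultimately show ?thesis by simp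
qed

fun translate :: "'a::{field,finite} \<Rightarrow> 'a vertex \<Rightarrow> 'a vertex" where
  "translate k (Point a b c) = Point a b (c + k)"
| "translate k (Line x y z) = Line x y (z - k)"

lemma translate_translate: "translate k (translate l v) = translate (k + l) v"
  by (cases v) (auto simp: algebra_simps)

lemma translate_0: "translate 0 v = v"
  by (cases v) auto

lemma bij_translate: "bij (translate k)"
  by (rule bijI') (metis translate_translate translate_0 add.right_inverse add.left_inverse)+

lemma graph_isomorphism_comp:
  "graph_isomorphism H K \<phi> \<Longrightarrow> graph_isomorphism K M \<psi> \<Longrightarrow> graph_isomorphism H M (\<psi> \<circ> \<phi>)"
  by (auto simp: graph_isomorphism_def intro: bij_comp)

lemma translate_automorphism: "graph_isomorphism R_graph R_graph (translate k)"
proof -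
  have "R_graph (translate k u) (translate k v) \<longleftrightarrow> R_graph u v" for u v :: "'a vertex"
    by (cases u; cases v) auto
  then show ?thesis
    by (simp add: graph_isomorphism_def bij_translate)
qed

lemma card_saturated_Line_0_0:
  fixes z :: "'a::{field,finite}"
  assumes card: "card (UNIV :: 'a set) \<ge> 7"
  defines "p \<equiv> card (UNIV :: 'a set)"
  shows "card {u. R_saturated u (Line 0 0 z)} = (p - 1) + (p - 2)"
proof -
  let ?f = "\<lambda>b. Point 0 b (- z)" and ?g = "\<lambda>a. Point a (- a / (a + 1)) (- z)"
  let ?S = "{u. R_saturated u (Line 0 0 z)}"
  have "?S = ?f ` (UNIV - {0}) \<union> ?g ` (UNIV - {0, - 1})"
  proof (intro equalityI subsetI)
    fix u assume u: "u \<in> ?S"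
    then obtain a b c where abc: "u = Point a b c"
      using card by (cases u) (auto simp: R_saturated_bipartite[OF card])
    from u have b: "b \<noteq> 0" "c = - z" "a = 0 \<or> a + b + a * b = 0"
      by (auto simp: abc R_saturated_iff[OF card])
    show "u \<in> ?f ` (UNIV - {0}) \<union> ?g ` (UNIV - {0, - 1})"
    proof (cases "a = 0")
      case False
      then have eq: "(a + 1) * b = - a" using b(3) by (simp add: algebra_simps eq_neg_iff_add_eq_0)
      then have "a + 1 \<noteq> 0" using False by auto
      then have "b = - a / (a + 1)" "a \<noteq> - 1"
        using eq by (auto simp: field_simps eq_neg_iff_add_eq_0)
      then show ?thesis using False b abc by auto
    qed (use b abc in auto)
  next
    fix u assume "u \<in> ?f ` (UNIV - {0}) \<union> ?g ` (UNIV - {0, - 1})"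
    then show "u \<in> ?S"
    proof
      assume "u \<in> ?g ` (UNIV - {0, - 1})"
      then obtain a where a: "a \<noteq> 0" "a \<noteq> - 1" "u = ?g a" by auto
      then have "a + 1 \<noteq> 0" by (simp add: eq_neg_iff_add_eq_0)
      then have "a + - a / (a + 1) + a * (- a / (a + 1)) = 0" by (simp add: field_simps)
      then show ?thesis using a \<open>a + 1 \<noteq> 0\<close> by (simp add: R_saturated_iff[OF card])
    qed (auto simp: R_saturated_iff[OF card])
  qed
  moreover have "inj_on ?f (UNIV - {0})" "inj_on ?g (UNIV - {0, - 1})"
    by (auto simp: inj_on_def)
  moreover have "?f ` (UNIV - {0}) \<inter> ?g ` (UNIV - {0, - 1}) = {}"
    by auto
  moreover have "card (UNIV - {0, - 1 :: 'a}) = p - 2" "card (UNIV - {0 :: 'a}) = p - 1"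
    by (subst card_Diff_subset; simp add: p_def)+
  ultimately show ?thesis
    by (simp add: card_Un_disjoint card_image)
qed

lemma card_saturated_Line_0_1:
  fixes z :: "'a::{field,finite}"
  assumes card: "card (UNIV :: 'a set) \<ge> 7" and two: "(2::'a) \<noteq> 0"
  defines "p \<equiv> card (UNIV :: 'a set)"
  shows "card {u. R_saturated u (Line 0 1 z)} = (p - 1) + (p - 3)"
proof -
  let ?f = "\<lambda>b. Point 0 b (1 + b - z)" and ?g = "\<lambda>a. Point a (1 / (a + 1)) (1 + 1 / (a + 1) - z)"
  let ?S = "{u. R_saturated u (Line 0 1 z)}"
  have "?S = ?f ` (UNIV - {- 1}) \<union> ?g ` (UNIV - {0, - 1, - 2})"
  proof (intro equalityI subsetI)
    fix u assume u: "u \<in> ?S"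
    then obtain a b c where abc: "u = Point a b c"
      using card by (cases u) (auto simp: R_saturated_bipartite[OF card])
    from u have b: "b \<noteq> - 1" "c = 1 + b - z" "a = 0 \<or> (a + 1) * b = 1"
      by (auto simp: abc R_saturated_iff[OF card])
    show "u \<in> ?f ` (UNIV - {- 1}) \<union> ?g ` (UNIV - {0, - 1, - 2})"
    proof (cases "a = 0")
      case False
      then have eq: "(a + 1) * b = 1" using b(3) by simp
      then have ne: "a + 1 \<noteq> 0" by auto
      then have b1: "b = 1 / (a + 1)" using eq by (simp add: field_simps)
      have "a \<noteq> - 1" using ne by auto
      moreover have "a \<noteq> - 2" using b1 b(1) by auto
      ultimately show ?thesis using False b b1 abc by auto
    qed (use b abc in auto)
  next
    fix u assume "u \<in> ?f ` (UNIV - {- 1}) \<union> ?g ` (UNIV - {0, - 1, - 2})"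
    then show "u \<in> ?S"
    proof
      assume "u \<in> ?g ` (UNIV - {0, - 1, - 2})"
      then obtain a where a: "a \<noteq> 0" "a \<noteq> - 1" "a \<noteq> - 2" "u = ?g a" by auto
      then have ne: "a + 1 \<noteq> 0" by (simp add: eq_neg_iff_add_eq_0)
      moreover have "1 / (a + 1) \<noteq> - 1"
      proof
        assume "1 / (a + 1) = - 1"
        then have "1 = - (a + 1)" using ne by (simp add: field_simps)
        then have "a + 1 = - 1" by (metis minus_minus)
        then have "a = - 1 - 1" by (metis add_diff_cancel_right')
        then have "a = - 2" by simp
        with a show False by simp
      qed
      ultimately show ?thesis using a by (simp add: R_saturated_iff[OF card])
    qed (auto simp: R_saturated_iff[OF card])
  qed
  moreover have "inj_on ?f (UNIV - {- 1})" "inj_on ?g (UNIV - {0, - 1, - 2})"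
    by (auto simp: inj_on_def)
  moreover have "?f ` (UNIV - {- 1}) \<inter> ?g ` (UNIV - {0, - 1, - 2}) = {}"
    by auto
  moreover have "card (UNIV - {0, - 1, - 2 :: 'a}) = p - 3" "card (UNIV - {- 1 :: 'a}) = p - 1"
  proof -
    have "(1 :: 'a) \<noteq> 2" by (metis add_cancel_right_left one_add_one zero_neq_one)
    then show "card (UNIV - {0, - 1, - 2 :: 'a}) = p - 3" "card (UNIV - {- 1 :: 'a}) = p - 1"
      using two by (subst card_Diff_subset; simp add: p_def)+
  qed
  ultimately show ?thesis
    by (simp add: card_Un_disjoint card_image)
qed

lemma card_saturated_other:
  fixes v :: "'a::{field,finite} vertex"
  assumes card: "card (UNIV :: 'a set) \<ge> 7"
    and v: "\<And>z. v \<noteq> Line 0 0 z" "\<And>z. v \<noteq> Line 0 1 z"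
  shows "card {u. R_saturated u v} \<le> 2"
proof (cases v)
  case (Point a b c)
  have "{u. R_saturated u v} \<subseteq> {Line 0 0 (- c), Line 0 1 (1 + b - c)}"
  proof
    fix u assume u: "u \<in> {u. R_saturated u v}"
    then obtain x y z where "u = Line x y z"
      using card Point by (cases u) (auto simp: R_saturated_bipartite[OF card])
    moreover have "R_saturated v u"
      using u R_saturated_sym by blast
    ultimately show "u \<in> {Line 0 0 (- c), Line 0 1 (1 + b - c)}"
      by (auto simp: Point R_saturated_iff[OF card])
  qed
  then have "card {u. R_saturated u v} \<le> card {Line 0 0 (- c), Line 0 1 (1 + b - c)}"
    by (intro card_mono) auto
  then show ?thesis by simp
next
  case (Line x y z)
  have "\<not> R_saturated u v" for u
    using card v by (cases u) (auto simp: Line R_saturated_bipartite[OF card] R_saturated_iff[OF card])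
  then show ?thesis by simp
qed

locale R_automorphism =
  fixes \<phi> :: "'a::{field,finite} vertex \<Rightarrow> 'a vertex"
  assumes prime: "prime (card (UNIV :: 'a set))"
    and card: "card (UNIV :: 'a set) \<ge> 7"
    and automorphism: "graph_isomorphism R_graph R_graph \<phi>"
begin

lemma two_neq_0: "(2 :: 'a) \<noteq> 0"
proof
  assume "(2 :: 'a) = 0"
  then have two: "(1 :: 'a) + 1 = 0" by simp
  then have "(- 1 :: 'a) = 1" by (metis add_eq_0_iff)
  then have "(c + 1 = 0 \<or> c + 1 = 1) = (c = 0 \<or> c = 1)" for c :: 'a
    by (auto simp: add_eq_0_iff2)
  then have "(c = 0 \<or> c = 1) = (0 = (0::'a) \<or> 0 = (1::'a))" for c :: 'a
    by (rule invariant_under_increment[OF prime, of "\<lambda>c. c = 0 \<or> c = 1"])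
  then have "UNIV = {0, 1 :: 'a}" by auto
  then have "card (UNIV :: 'a set) \<le> 2" by (metis card_2_iff le_refl zero_neq_one)
  with card show False by simp
qed

lemma adj [simp]: "R_graph (\<phi> u) (\<phi> v) \<longleftrightarrow> R_graph u v"
  using automorphism by (simp add: graph_isomorphism_def)

lemma saturated [simp]: "R_saturated (\<phi> u) (\<phi> v) \<longleftrightarrow> R_saturated u v"
  unfolding R_saturated_def by (rule saturated_automorphism[OF automorphism])

lemma card_saturated: "card {u. R_saturated u (\<phi> v)} = card {u. R_saturated u v}"
  unfolding R_saturated_def by (rule card_saturated_automorphism[OF automorphism])

lemma Line_0_0: "\<exists>w. \<phi> (Line 0 0 z) = Line 0 0 w"
proof (rule ccontr)
  assume "\<not> ?thesis"
  then have not_0: "\<phi> (Line 0 0 z) \<noteq> Line 0 0 w" for w by blast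
  have *: "card {u. R_saturated u (\<phi> (Line 0 0 z))} =
      (card (UNIV :: 'a set) - 1) + (card (UNIV :: 'a set) - 2)"
    using card_saturated_Line_0_0[OF card] by (simp only: card_saturated)
  show False
  proof (cases "\<exists>w. \<phi> (Line 0 0 z) = Line 0 1 w")
    case True
    then show False
      using * card card_saturated_Line_0_1[OF card two_neq_0] by auto
  next
    case False
    then have not_1: "\<phi> (Line 0 0 z) \<noteq> Line 0 1 w" for w by blast
    show False
      using card_saturated_other[OF card not_0 not_1] * card by simp
  qed
qed

lemma Line_0_1: "\<exists>w. \<phi> (Line 0 1 z) = Line 0 1 w"
proof (rule ccontr)
  assume "\<not> ?thesis"
  then have not_1: "\<phi> (Line 0 1 z) \<noteq> Line 0 1 w" for w by blast
  have *: "card {u. R_saturated u (\<phi> (Line 0 1 z))} =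
      (card (UNIV :: 'a set) - 1) + (card (UNIV :: 'a set) - 3)"
    using card_saturated_Line_0_1[OF card two_neq_0] by (simp only: card_saturated)
  show False
  proof (cases "\<exists>w. \<phi> (Line 0 1 z) = Line 0 0 w")
    case True
    then show False
      using * card card_saturated_Line_0_0[OF card] by auto
  next
    case False
    then have not_0: "\<phi> (Line 0 1 z) \<noteq> Line 0 0 w" for w by blast
    show False
      using card_saturated_other[OF card not_0 not_1] * card by simp
  qed
qed

end

locale normalized_R_automorphism = R_automorphism +
  assumes normalized: "\<phi> (Line 0 0 0) = Line 0 0 0"
begin

lemma fixes_Line_0_0_1: "\<phi> (Line 0 0 z) = Line 0 0 z" "\<phi> (Line 0 1 z) = Line 0 1 z"
proof -
  obtain s where s: "\<And>z. \<phi> (Line 0 0 z) = Line 0 0 (s z)" using Line_0_0 by metis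
  obtain t where t: "\<And>z. \<phi> (Line 0 1 z) = Line 0 1 (t z)" using Line_0_1 by metis
  have step: "s z = t (z + 1) - 1" for z
  proof -
    have "R_saturated (Point 0 0 (- z)) (Line 0 1 (z + 1))" "R_graph (Point 0 0 (- z)) (Line 0 0 z)"
      by (auto simp: R_saturated_iff[OF card] height_def)
    then have *: "R_saturated (\<phi> (Point 0 0 (- z))) (Line 0 1 (t (z + 1)))"
      "R_graph (\<phi> (Point 0 0 (- z))) (Line 0 0 (s z))"
      by (metis saturated t, metis adj s)
    then obtain a b c where "\<phi> (Point 0 0 (- z)) = Point a b c"
      by (cases "\<phi> (Point 0 0 (- z))") auto
    with * have "c = - s z" "c = 1 - t (z + 1)"
      by (auto simp: R_saturated_iff[OF card] add_eq_0_iff2)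
    then show ?thesis by (metis minus_diff_eq minus_equation_iff)
  qed
  have same: "t z = s z" for z
  proof -
    have "R_saturated (Point 0 (- 1) (- z)) (Line 0 0 z)" "R_graph (Point 0 (- 1) (- z)) (Line 0 1 z)"
      by (auto simp: R_saturated_iff[OF card] height_def)
    then have *: "R_saturated (\<phi> (Point 0 (- 1) (- z))) (Line 0 0 (s z))"
      "R_graph (\<phi> (Point 0 (- 1) (- z))) (Line 0 1 (t z))"
      by (metis saturated s, metis adj t)
    then obtain a b c where "\<phi> (Point 0 (- 1) (- z)) = Point a b c"
      by (cases "\<phi> (Point 0 (- 1) (- z))") auto
    with * have "c = - s z" "c = - t z"
      by (auto simp: R_saturated_iff[OF card] add_eq_0_iff2)
    then show ?thesis by simp
  qed
  have "s (z + 1) - (z + 1) = s z - z" for z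
    using step[of z] same by simp
  then have "s z - z = s 0 - 0" for z
    by (rule invariant_under_increment[OF prime, of "\<lambda>z. s z - z"])
  moreover have "s 0 = 0" using s[of 0] normalized by simp
  ultimately have "s z = z" for z by simp
  then show "\<phi> (Line 0 0 z) = Line 0 0 z" "\<phi> (Line 0 1 z) = Line 0 1 z"
    using s t same by auto
qed

lemma fixes_Point_0: "\<phi> (Point 0 b c) = Point 0 b c"
proof -
  have image: "\<exists>a' b' c'. \<phi> (Point 0 b c) = Point a' b' c'"
  proof (cases "b = 0")
    case True
    then have "R_graph (Point 0 b c) (Line 0 0 (- c))" by simp
    then have "R_graph (\<phi> (Point 0 b c)) (Line 0 0 (- c))" by (metis adj fixes_Line_0_0_1(1))
    then show ?thesis by (cases "\<phi> (Point 0 b c)") auto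
  next
    case False
    then have "R_saturated (Point 0 b c) (Line 0 0 (- c))" by (simp add: R_saturated_iff[OF card])
    then have "R_saturated (\<phi> (Point 0 b c)) (Line 0 0 (- c))" by (metis saturated fixes_Line_0_0_1(1))
    then show ?thesis
      by (cases "\<phi> (Point 0 b c)") (auto simp: R_saturated_bipartite[OF card])
  qed
  then obtain a' b' c' where P: "\<phi> (Point 0 b c) = Point a' b' c'" by blast
  have S0: "R_saturated (Point 0 b c) (Line 0 0 z) \<longleftrightarrow> R_saturated (Point a' b' c') (Line 0 0 z)" for z
    by (metis P saturated fixes_Line_0_0_1(1))
  have S1: "R_saturated (Point 0 b c) (Line 0 1 z) \<longleftrightarrow> R_saturated (Point a' b' c') (Line 0 1 z)" for z
    by (metis P saturated fixes_Line_0_0_1(2))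
  have A0: "R_graph (Point 0 b c) (Line 0 0 z) \<longleftrightarrow> R_graph (Point a' b' c') (Line 0 0 z)" for z
    by (metis P adj fixes_Line_0_0_1(1))
  have A1: "R_graph (Point 0 b c) (Line 0 1 z) \<longleftrightarrow> R_graph (Point a' b' c') (Line 0 1 z)" for z
    by (metis P adj fixes_Line_0_0_1(2))
  consider "b = 0" | "b = - 1" | "b \<noteq> 0" "b \<noteq> - 1" by blast
  then have "a' = 0 \<and> b' = b \<and> c' = c"
  proof cases
    case 1
    then show ?thesis
      using A0[of "- c"] S1[of "1 - c"] by (auto simp: R_saturated_iff[OF card])
  next
    case 2
    then have "b' + 1 = 0" "c' = c"
      using A1[of "- c"] by (auto simp: add_eq_0_iff2)
    then have "b' = - 1" by (simp add: eq_neg_iff_add_eq_0)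
    then show ?thesis
      using 2 S0[of "- c"] \<open>c' = c\<close> by (auto simp: R_saturated_iff[OF card])
  next
    case 3
    then have "c' = c" "a' = 0 \<or> a' + b' + a' * b' = 0"
      using S0[of "- c"] by (auto simp: R_saturated_iff[OF card])
    moreover have "c' = b' - b + c" "a' = 0 \<or> (a' + 1) * b' = 1"
      using 3 S1[of "1 + b - c"] by (auto simp: R_saturated_iff[OF card])
    moreover have "a' = 0" if "a' + b' + a' * b' = 0" "(a' + 1) * b' = 1"
    proof -
      have "a' + 1 = 0" using that by (simp add: algebra_simps)
      with that(2) show ?thesis by simp
    qed
    ultimately show ?thesis by auto
  qed
  then show ?thesis using P by simp
qed

lemma Line_image: "\<exists>x'. \<phi> (Line x y z) = Line x' y z"
proof -
  have "R_graph (Line x y z) (Point 0 (- y) (- z))" by (simp add: height_def)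
  then have "R_graph (\<phi> (Line x y z)) (Point 0 (- y) (- z))" by (metis adj fixes_Point_0)
  then show ?thesis
    by (cases "\<phi> (Line x y z)") (auto simp: height_def add_eq_0_iff2)
qed

lemma fixes_Line_0: "\<phi> (Line 0 y z) = Line 0 y z"
proof (cases "y = 0")
  case True
  then show ?thesis using fixes_Line_0_0_1 by simp
next
  case False
  obtain x where x: "\<phi> (Line 0 y z) = Line x y z" using Line_image by blast
  have "x = 0"
  proof (rule ccontr)
    assume "x \<noteq> 0"
    obtain v where v: "\<phi> v = Point (y / x) 0 (- z)"
      using automorphism by (metis graph_isomorphism_def bij_pointE)
    have "R_graph (\<phi> v) (\<phi> (Line 0 y z))" "R_graph (\<phi> v) (\<phi> (Line 0 0 z))"
      using \<open>x \<noteq> 0\<close> by (auto simp: v x fixes_Line_0_0_1 height_def)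
    then have "R_graph v (Line 0 y z)" "R_graph v (Line 0 0 z)" by simp_all
    then show False using False by (cases v) auto
  qed
  then show ?thesis using x by simp
qed

lemma Point_image: "\<exists>a'. \<phi> (Point a b c) = Point a' b c"
proof -
  have "R_graph (Point a b c) (Line 0 (- b) (- c))" by simp
  then have "R_graph (\<phi> (Point a b c)) (Line 0 (- b) (- c))" by (metis adj fixes_Line_0)
  then show ?thesis
    by (cases "\<phi> (Point a b c)") (auto simp: add_eq_0_iff2)
qed

lemma fixes_generic_Point:
  assumes "b \<noteq> 0" "b \<noteq> - 1"
  shows "\<phi> (Point a b c) = Point a b c"
proof (cases "a = 0")
  case False
  obtain a' where a': "\<phi> (Point a b c) = Point a' b c" using Point_image by blast
  let ?L = "Line (1 / a) (1 - b) (height a b / a - c)"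
  obtain x where x: "\<phi> ?L = Line x (1 - b) (height a b / a - c)" using Line_image by blast
  have "R_graph (Point a b c) ?L" using False by simp
  then have "R_graph (\<phi> (Point a b c)) (\<phi> ?L)" by simp
  then have *: "a' * x = 1" "height a b / a = x * height a' b"
    by (auto simp: a' x)
  have "height a b / a = b * (a + b + a * b)"
    using False by (simp add: height_def)
  moreover have "x * height a' b = (a' * x) * (b * (a' + b + a' * b))"
    by (simp add: height_def algebra_simps)
  ultimately have "b * (a + b + a * b) = b * (a' + b + a' * b)"
    by (metis * mult_1)
  then have "a + b + a * b = a' + b + a' * b" using assms by simp
  then have "(a - a') * (b + 1) = 0" by (simp add: algebra_simps)
  then have "a = a'" using assms by (simp add: eq_neg_iff_add_eq_0)
  then show ?thesis using a' by simp
qed (simp add: fixes_Point_0)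

lemma fixes_Line: "\<phi> (Line x y z) = Line x y z"
proof (cases "x = 0")
  case False
  obtain x' where x': "\<phi> (Line x y z) = Line x' y z" using Line_image by blast
  have "card {0, - 1, - y} \<le> 3" by (simp add: card_insert_if)
  then have "{0, - 1, - y} \<noteq> UNIV" using card by auto
  then obtain b where b: "b \<noteq> 0" "b \<noteq> - 1" "b \<noteq> - y" by blast
  let ?a = "(b + y) / x"
  have "R_graph (Point ?a b (x * height ?a b - z)) (Line x y z)" using False by simp
  then have "R_graph (Point ?a b (x * height ?a b - z)) (Line x' y z)"
    using fixes_generic_Point[OF b(1,2)] by (metis adj x')
  then have "(b + y) * x = (b + y) * x'" using False by (simp add: field_simps)
  moreover have "b + y \<noteq> 0" using b(3) by (simp add: eq_neg_iff_add_eq_0)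
  ultimately show ?thesis using x' by simp
qed (simp add: fixes_Line_0)

lemma fixes_Point: "\<phi> (Point a b c) = Point a b c"
proof -
  obtain a' where a': "\<phi> (Point a b c) = Point a' b c" using Point_image by blast
  have "R_graph (Point a b c) (Line 1 (a - b) (height a b - c))" by simp
  then have "R_graph (Point a' b c) (Line 1 (a - b) (height a b - c))" by (metis adj fixes_Line a')
  then show ?thesis using a' by simp
qed

lemma eq_id: "\<phi> v = v"
  by (cases v) (simp_all add: fixes_Point fixes_Line)

end

lemma carrier_Aut_R_graph:
  assumes prime: "prime (card (UNIV :: 'a::{field,finite} set))"
    and card: "card (UNIV :: 'a set) \<ge> 7"
  shows "carrier (Aut (R_graph :: 'a vertex graph)) = range translate"
proof (intro equalityI subsetI)
  fix \<phi> :: "'a vertex \<Rightarrow> 'a vertex"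
  assume "\<phi> \<in> carrier (Aut R_graph)"
  then interpret R_automorphism \<phi>
    using assms by unfold_locales (auto simp: Aut_def)
  obtain k where k: "\<phi> (Line 0 0 0) = Line 0 0 k" using Line_0_0 by blast
  interpret normalized: normalized_R_automorphism "translate k \<circ> \<phi>"
    using graph_isomorphism_comp[OF automorphism translate_automorphism, of k] assms
    by unfold_locales (auto simp: k)
  have "\<phi> v = translate (- k) v" for v
    using normalized.eq_id[of v] by (metis comp_apply translate_translate translate_0 add.left_inverse)
  then show "\<phi> \<in> range translate" by blast
qed (auto simp: Aut_def translate_automorphism)

lemma order_Aut_R_graph:
  assumes "prime (card (UNIV :: 'a::{field,finite} set))" and "card (UNIV :: 'a set) \<ge> 7"
  shows "order (Aut (R_graph :: 'a vertex graph)) = card (UNIV :: 'a set)"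
proof -
  have "inj (translate :: 'a \<Rightarrow> _)"
  proof
    fix k l :: 'a assume "translate k = translate l"
    then have "translate k (Point 0 0 0) = translate l (Point 0 0 0)" by simp
    then show "k = l" by simp
  qed
  then show ?thesis
    by (simp add: Coset.order_def carrier_Aut_R_graph[OF assms] card_image)
qed

lemma order_Aut_isomorphic:
  assumes "graph_isomorphic H K"
  shows "order (Aut H) = order (Aut K)"
proof -
  obtain \<psi> where \<psi>: "graph_isomorphism H K \<psi>"
    using assms by (auto simp: graph_isomorphic_def)
  then have bij: "bij \<psi>" by (simp add: graph_isomorphism_def)
  let ?\<psi>' = "inv_into UNIV \<psi>"
  have inv: "\<psi> \<circ> ?\<psi>' = id" "?\<psi>' \<circ> \<psi> = id"
    using bij by (auto simp: fun_eq_iff bij_is_surj surj_f_inv_f bij_is_inj)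
  have "K u v \<longleftrightarrow> H (?\<psi>' u) (?\<psi>' v)" for u v
    using \<psi> bij by (metis graph_isomorphism_def bij_is_surj surj_f_inv_f)
  then have \<psi>': "graph_isomorphism K H ?\<psi>'"
    using bij by (simp add: graph_isomorphism_def bij_imp_bij_inv)
  have "bij_betw (\<lambda>\<phi>. \<psi> \<circ> \<phi> \<circ> ?\<psi>') (carrier (Aut H)) (carrier (Aut K))"
  proof (rule bij_betw_byWitness[where f' = "\<lambda>\<phi>. ?\<psi>' \<circ> \<phi> \<circ> \<psi>"])
    show "\<forall>\<phi>\<in>carrier (Aut H). ?\<psi>' \<circ> (\<psi> \<circ> \<phi> \<circ> ?\<psi>') \<circ> \<psi> = \<phi>"
      using inv by (metis comp_assoc comp_id id_comp)
    show "\<forall>\<phi>\<in>carrier (Aut K). \<psi> \<circ> (?\<psi>' \<circ> \<phi> \<circ> \<psi>) \<circ> ?\<psi>' = \<phi>"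
      using inv by (metis comp_assoc comp_id id_comp)
  qed (use \<psi> \<psi>' in \<open>auto simp: Aut_def intro: graph_isomorphism_comp\<close>)
  then show ?thesis
    by (simp add: Coset.order_def bij_betw_same_card)
qed

fun translate2 :: "'a::{field,finite} \<times> 'a \<Rightarrow> 'a vertex \<Rightarrow> 'a vertex" where
  "translate2 (k, l) (Point a b c) = Point a (b + k) (c + l)"
| "translate2 (k, l) (Line x y z) = Line x (y - k) (z - l)"

lemma order_Aut_Gamma2:
  fixes f h :: "'a::{field,finite} \<Rightarrow> 'a \<Rightarrow> 'a"
  shows "order (Aut (Gamma2 f h)) \<ge> card (UNIV :: 'a set) ^ 2"
proof -
  have "translate2 q \<in> carrier (Aut (Gamma2 f h))" for q
  proof -
    obtain k l where q: "q = (k, l)" by fastforce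
    have "translate2 (k, l) (translate2 (- k, - l) v) = v"
      "translate2 (- k, - l) (translate2 (k, l) v) = v" for v
      by (cases v; simp)+
    then have "bij (translate2 (k, l))" by (metis bijI')
    moreover have "Gamma2 f h (translate2 (k, l) u) (translate2 (k, l) v) \<longleftrightarrow> Gamma2 f h u v" for u v
      by (cases u; cases v) (auto simp: Gamma2_def Gamma_def)
    ultimately show ?thesis
      by (simp add: q Aut_def graph_isomorphism_def)
  qed
  then have "range translate2 \<subseteq> carrier (Aut (Gamma2 f h))" by blast
  moreover have "finite (UNIV :: 'a vertex set)"
  proof (rule finite_surj)
    show "UNIV \<subseteq> (\<lambda>(s, a, b, c). if s then Point a b c else Line a b c) ` (UNIV :: (bool \<times> 'a \<times> 'a \<times> 'a) set)"
    proof
      fix v :: "'a vertex"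
      show "v \<in> (\<lambda>(s, a, b, c). if s then Point a b c else Line a b c) ` UNIV"
      proof (cases v)
        case (Point a b c)
        then show ?thesis by (intro image_eqI[of _ _ "(True, a, b, c)"]) auto
      next
        case (Line a b c)
        then show ?thesis by (intro image_eqI[of _ _ "(False, a, b, c)"]) auto
      qed
    qed
  qed simp
  then have "finite (carrier (Aut (Gamma2 f h)))"
    using finite_set_of_finite_funs[of "UNIV :: 'a vertex set" "UNIV :: 'a vertex set"]
    by (auto intro: finite_subset)
  ultimately have "card (range (translate2 :: 'a \<times> 'a \<Rightarrow> _)) \<le> order (Aut (Gamma2 f h))"
    unfolding Coset.order_def by (intro card_mono)
  moreover have "inj (translate2 :: 'a \<times> 'a \<Rightarrow> _)"
  proof
    fix q r :: "'a \<times> 'a" assume "translate2 q = translate2 r"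
    then have "translate2 q (Point 0 0 0) = translate2 r (Point 0 0 0)" by simp
    then show "q = r" by (cases q; cases r) simp
  qed
  then have "card (range (translate2 :: 'a \<times> 'a \<Rightarrow> _)) = card (UNIV :: 'a set) ^ 2"
    by (simp add: card_image power2_eq_square card_cartesian_product flip: UNIV_Times_UNIV)
  ultimately show ?thesis by simp
qed

theorem theorem2p1:
  fixes p :: nat
  assumes "prime p"
    and "p mod 3 = 1"
    and "card (UNIV :: 'a::{field,finite} set) = p"
  shows "order (Aut (R_graph :: 'a vertex graph)) = p \<and>
    \<not> (\<exists>h :: 'a \<Rightarrow> 'a \<Rightarrow> 'a.
          graph_isomorphic (R_graph :: 'a vertex graph) (Gamma2 (\<lambda>p1 l1. p1 * l1) h))"
proof -
  have "p \<noteq> 4" using \<open>prime p\<close> by (auto simp: prime_nat_numeral_eq)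
  moreover have "p > 1" using \<open>prime p\<close> by (rule prime_gt_1_nat)
  ultimately have "p \<ge> 7" using \<open>p mod 3 = 1\<close> by presburger
  then have order: "order (Aut (R_graph :: 'a vertex graph)) = p"
    using order_Aut_R_graph assms by metis
  moreover have False if "graph_isomorphic (R_graph :: 'a vertex graph) (Gamma2 (\<lambda>p1 l1. p1 * l1) h)"
    for h :: "'a \<Rightarrow> 'a \<Rightarrow> 'a"
  proof -
    have "p\<^sup>2 \<le> p"
      using order_Aut_isomorphic[OF that] order order_Aut_Gamma2[of "\<lambda>p1 l1. p1 * l1" h] assms(3) by simp
    then show False using \<open>p > 1\<close> by (simp add: power2_eq_square)
  qed
  ultimately show ?thesis by blast
qed

end
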